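(* Suppose that $a_1, a_2, \ldots, a_n$ is a finite sequence of distinct positive real numbers. Then there exists a polynomial $p$ (with complex coefficients), of degree $4n+1$, such that the maximum modulus set $\mathcal{M}(p)$ has singleton components at the points $a_1, a_2, \ldots, a_n$; that is, for each $k \in \{1,\ldots,n\}$ the set $\{a_k\}$ is a connected component of $\mathcal{M}(p)$.
   Context: For an entire function $f:\mathbb{C}\to\mathbb{C}$ (in particular a polynomial), the maximum modulus is $M(r,f) := \max_{|z|=r}|f(z)|$ for $r \ge 0$, and the maximum modulus set is $\mathcal{M}(f) := \{z \in \mathbb{C} : |f(z)| = M(|z|,f)\}$. Positive real numbers are regarded as points of $\mathbb{C}$. *)

theory Defs
  imports "HOL-Analysis.Analysis" "HOL-Computational_Algebra.Polynomial"
begin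

(* For continuous f and r >= 0 the circle is compact and nonempty, so this supremum is attained
   and is the maximum of |f| over |z| = r. *)
definition max_modulus :: "real \<Rightarrow> (complex \<Rightarrow> complex) \<Rightarrow> real" where
  "max_modulus r f = (SUP z \<in> sphere 0 r. cmod (f z))"

definition max_modulus_set :: "(complex \<Rightarrow> complex) \<Rightarrow> complex set" where
  "max_modulus_set f = {z. cmod (f z) = max_modulus (cmod z) f}"

end

theory Submission
  imports Defs
begin

text \<open>
  Let \<open>n \<ge> 1\<close> and take \<open>p = q - \<epsilon> E\<close> with \<open>q = z\<^sup>m (z\<^sup>2 + 1)\<close>, \<open>m = 4n - 1\<close>, \<open>E = (\<Prod>k. (z\<^sup>2 - a\<^sub>k\<^sup>2)\<^sup>2)\<close> and a small
  \<open>\<epsilon> > 0\<close>. The odd polynomial \<open>q\<close> has its maximum modulus exactly on the real axis, and if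
  \<open>r = cmod z\<close> and \<open>Re z \<ge> 0\<close>, then \<open>(cmod (q z))\<^sup>2\<close> falls below \<open>(q r)\<^sup>2\<close> by at least a positive
  multiple of \<open>r - Re z\<close>, uniformly on an annulus that contains all the \<open>a\<^sub>k\<close>
  (\<open>cmod_dominant_poly_le\<close>).

  Because the coefficients are real, \<open>\<epsilon> E\<close> disturbs the difference of these squares by only
  \<open>O(\<epsilon> (r - Re z))\<close>: the modulus is symmetric under conjugation, so it has no term of first order
  in \<open>Im z\<close>, that is, of order \<open>sqrt (r - Re z)\<close> (\<open>real_poly_product_deviation\<close>). Hence for small
  \<open>\<epsilon>\<close> the maximum of \<open>p\<close> over each circle of the annulus can be attained only at \<open>r\<close> or \<open>-r\<close>
  (\<open>small_perturbation_max_on_axis\<close>; the left half plane is reduced to the right one by the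
  parities of \<open>q\<close> and \<open>E\<close>).

  It remains to compare \<open>cmod (p (-r)) = q r + \<epsilon> E r\<close> with \<open>cmod (p r) = \<bar>q r - \<epsilon> E r\<bar>\<close>. As
  \<open>q r > 0\<close> and \<open>E r \<ge> 0\<close>, the negative axis wins unless \<open>E r = 0\<close>, that is, unless \<open>r\<close> is one of
  the \<open>a\<^sub>k\<close>, where there is a tie. So in the right half of the annulus the maximum modulus set is
  the finite set of the \<open>a\<^sub>k\<close>, and each of them is an isolated point of the maximum modulus set.
\<close>

section \<open>Real polynomials near the positive axis\<close>

lemma Im_squared_eq: "(Im z)\<^sup>2 = (cmod z - Re z) * (cmod z + Re z)"
  by (simp add: cmod_def algebra_simps power2_eq_square flip: real_sqrt_mult)

lemma Im_squared_le:
  assumes "cmod z \<le> R"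
  shows "(Im z)\<^sup>2 \<le> 2 * R * (cmod z - Re z)"
proof -
  have "(cmod z - Re z) * (cmod z + Re z) \<le> (cmod z - Re z) * (2 * R)"
    using assms complex_Re_le_cmod[of z] by (intro mult_left_mono) auto
  then show ?thesis by (simp add: Im_squared_eq mult.commute)
qed

text \<open>
  Conjugation symmetry makes the imaginary part odd and the real part even in \<open>Im z\<close>, so along a
  circle the latter moves away from its value on the positive axis only to second order. The
  quantity \<open>cmod z - Re z\<close> is the convenient measure of that order.
\<close>

lemma real_poly_deviation:
  fixes q :: "complex poly"
  assumes "\<And>i. coeff q i \<in> \<real>" and "R \<ge> 0"
  shows "\<exists>K\<ge>0. \<forall>z. cmod z \<le> R \<longrightarrow> cmod (poly q z) \<le> K \<and> \<bar>Im (poly q z)\<bar> \<le> K * \<bar>Im z\<bar> \<and>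
    \<bar>Re (poly q z) - Re (poly q (cmod z))\<bar> \<le> K * (cmod z - Re z)"
  using assms(1)
proof (induction q)
  case 0
  then show ?case by (intro exI[of _ 0]) auto
next
  case (pCons c q)
  have "\<And>i. coeff q i \<in> \<real>" using pCons.prems by (metis coeff_pCons_Suc)
  then obtain K where K: "K \<ge> 0"
    "\<And>z. cmod z \<le> R \<Longrightarrow> cmod (poly q z) \<le> K"
    "\<And>z. cmod z \<le> R \<Longrightarrow> \<bar>Im (poly q z)\<bar> \<le> K * \<bar>Im z\<bar>"
    "\<And>z. cmod z \<le> R \<Longrightarrow> \<bar>Re (poly q z) - Re (poly q (cmod z))\<bar> \<le> K * (cmod z - Re z)"
    using pCons.IH by blast
  have c: "Im c = 0" using pCons.prems[of 0] by (simp add: complex_is_Real_iff)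
  define L where "L = cmod c + K + 3 * (R * K)"
  have RK: "R * K \<ge> 0" using assms(2) K(1) by simp
  have "cmod (poly (pCons c q) z) \<le> L \<and> \<bar>Im (poly (pCons c q) z)\<bar> \<le> L * \<bar>Im z\<bar> \<and>
      \<bar>Re (poly (pCons c q) z) - Re (poly (pCons c q) (cmod z))\<bar> \<le> L * (cmod z - Re z)"
    if z: "cmod z \<le> R" for z
  proof (intro conjI)
    let ?q = "poly q z" and ?r = "cmod z" and ?t = "cmod z - Re z"
    have t: "?t \<ge> 0" using complex_Re_le_cmod[of z] by simp
    have x: "\<bar>Re z\<bar> \<le> R" using abs_Re_le_cmod[of z] z by linarith
    have "cmod (z * ?q) \<le> R * K"
      unfolding norm_mult using z K(2)[OF z] assms(2) by (intro mult_mono) auto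
    then show "cmod (poly (pCons c q) z) \<le> L"
      using norm_triangle_ineq[of c "z * ?q"] K(1) RK by (simp add: L_def)
    have a: "\<bar>Re z * Im ?q\<bar> \<le> R * (K * \<bar>Im z\<bar>)"
      unfolding abs_mult using x K(3)[OF z] assms(2) by (intro mult_mono) auto
    have b: "\<bar>Im z * Re ?q\<bar> \<le> \<bar>Im z\<bar> * K"
      unfolding abs_mult using K(2)[OF z] abs_Re_le_cmod[of ?q] by (intro mult_left_mono) auto
    have "\<bar>Im (poly (pCons c q) z)\<bar> \<le> (K + R * K) * \<bar>Im z\<bar>"
      using a b c by (simp add: algebra_simps)
    also have "\<dots> \<le> L * \<bar>Im z\<bar>"
      using RK by (intro mult_right_mono) (simp_all add: L_def add_nonneg_nonneg mult.commute)
    finally show "\<bar>Im (poly (pCons c q) z)\<bar> \<le> L * \<bar>Im z\<bar>" .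
    have d: "\<bar>Re z * (Re ?q - Re (poly q ?r))\<bar> \<le> R * (K * ?t)"
      unfolding abs_mult using x K(4)[OF z] assms(2) by (intro mult_mono) auto
    have e: "\<bar>?t * Re (poly q ?r)\<bar> \<le> ?t * K"
      unfolding abs_mult using K(2)[of "complex_of_real ?r"] z t abs_Re_le_cmod[of "poly q ?r"]
      by (intro mult_mono) auto
    have "\<bar>Im z * Im ?q\<bar> \<le> \<bar>Im z\<bar> * (K * \<bar>Im z\<bar>)"
      unfolding abs_mult using K(3)[OF z] by (intro mult_left_mono) auto
    also have "\<dots> = K * (Im z)\<^sup>2" by (simp add: power2_eq_square)
    also have "\<dots> \<le> K * (2 * R * ?t)"
      using Im_squared_le[OF z] K(1) by (rule mult_left_mono)
    finally have f: "\<bar>Im z * Im ?q\<bar> \<le> K * (2 * R * ?t)" .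
    have "Re (poly (pCons c q) z) - Re (poly (pCons c q) ?r)
        = Re z * (Re ?q - Re (poly q ?r)) - ?t * Re (poly q ?r) - Im z * Im ?q"
      by (simp add: algebra_simps)
    then have "\<bar>Re (poly (pCons c q) z) - Re (poly (pCons c q) ?r)\<bar>
        \<le> R * (K * ?t) + ?t * K + K * (2 * R * ?t)"
      using d e f by linarith
    also have "\<dots> = (K + 3 * (R * K)) * ?t" by (simp add: algebra_simps)
    also have "\<dots> \<le> L * ?t"
      using t by (intro mult_right_mono) (auto simp: L_def)
    finally show "\<bar>Re (poly (pCons c q) z) - Re (poly (pCons c q) ?r)\<bar> \<le> L * ?t" .
  qed
  moreover have "L \<ge> 0" using K(1) RK by (simp add: L_def)
  ultimately show ?case by blast
qed

text \<open>
  The form in which the second order estimate enters the expansion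
  \<open>(cmod (q + \<eta> s))\<^sup>2 = (cmod q)\<^sup>2 + 2 \<eta> Re (q * cnj s) + \<eta>\<^sup>2 (cmod s)\<^sup>2\<close>. Both imaginary parts are
  \<open>O(Im z)\<close>, so that their product is again of second order.
\<close>

lemma real_poly_product_deviation:
  fixes q s :: "complex poly"
  assumes "\<And>i. coeff q i \<in> \<real>" and "\<And>i. coeff s i \<in> \<real>" and "R \<ge> 0"
  shows "\<exists>K\<ge>0. \<forall>z. cmod z \<le> R \<longrightarrow>
    \<bar>Re (poly q z * cnj (poly s z)) - Re (poly q (cmod z) * cnj (poly s (cmod z)))\<bar>
      \<le> K * (cmod z - Re z)"
proof -
  obtain K where K: "K \<ge> 0"
    "\<And>z. cmod z \<le> R \<Longrightarrow> cmod (poly q z) \<le> K"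
    "\<And>z. cmod z \<le> R \<Longrightarrow> \<bar>Im (poly q z)\<bar> \<le> K * \<bar>Im z\<bar>"
    "\<And>z. cmod z \<le> R \<Longrightarrow> \<bar>Re (poly q z) - Re (poly q (cmod z))\<bar> \<le> K * (cmod z - Re z)"
    using real_poly_deviation[OF assms(1,3)] by blast
  obtain L where L: "L \<ge> 0"
    "\<And>z. cmod z \<le> R \<Longrightarrow> cmod (poly s z) \<le> L"
    "\<And>z. cmod z \<le> R \<Longrightarrow> \<bar>Im (poly s z)\<bar> \<le> L * \<bar>Im z\<bar>"
    "\<And>z. cmod z \<le> R \<Longrightarrow> \<bar>Re (poly s z) - Re (poly s (cmod z))\<bar> \<le> L * (cmod z - Re z)"
    using real_poly_deviation[OF assms(2,3)] by blast
  define M where "M = 2 * K * L + K * L * (2 * R)"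
  have "\<bar>Re (poly q z * cnj (poly s z)) - Re (poly q (cmod z) * cnj (poly s (cmod z)))\<bar>
      \<le> M * (cmod z - Re z)" if z: "cmod z \<le> R" for z
  proof -
    let ?r = "complex_of_real (cmod z)" and ?t = "cmod z - Re z"
    have t: "?t \<ge> 0" using complex_Re_le_cmod[of z] by simp
    have r: "cmod ?r \<le> R" using z by simp
    have Imr: "Im (poly q ?r) = 0" using K(3)[OF r] by simp
    have a: "\<bar>(Re (poly q z) - Re (poly q ?r)) * Re (poly s z)\<bar> \<le> (K * ?t) * L"
      unfolding abs_mult using K(1) t K(4)[OF z] L(2)[OF z] abs_Re_le_cmod[of "poly s z"]
      by (intro mult_mono) auto
    have b: "\<bar>Re (poly q ?r) * (Re (poly s z) - Re (poly s ?r))\<bar> \<le> K * (L * ?t)"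
      unfolding abs_mult using K(1) K(2)[OF r] L(4)[OF z] abs_Re_le_cmod[of "poly q ?r"]
      by (intro mult_mono) auto
    have "\<bar>Im (poly q z) * Im (poly s z)\<bar> \<le> (K * \<bar>Im z\<bar>) * (L * \<bar>Im z\<bar>)"
      unfolding abs_mult using K(1) K(3)[OF z] L(3)[OF z] by (intro mult_mono) auto
    also have "\<dots> = K * L * (Im z)\<^sup>2" by (simp add: power2_eq_square)
    also have "\<dots> \<le> K * L * (2 * R * ?t)"
      using Im_squared_le[OF z] K(1) L(1) by (intro mult_left_mono) auto
    finally have c: "\<bar>Im (poly q z) * Im (poly s z)\<bar> \<le> K * L * (2 * R * ?t)" .
    have "Re (poly q z * cnj (poly s z)) - Re (poly q ?r * cnj (poly s ?r))
        = (Re (poly q z) - Re (poly q ?r)) * Re (poly s z)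
          + Re (poly q ?r) * (Re (poly s z) - Re (poly s ?r)) + Im (poly q z) * Im (poly s z)"
      using Imr by (simp add: algebra_simps)
    then have "\<bar>Re (poly q z * cnj (poly s z)) - Re (poly q ?r * cnj (poly s ?r))\<bar>
        \<le> (K * ?t) * L + K * (L * ?t) + K * L * (2 * R * ?t)"
      using a b c by linarith
    also have "\<dots> = M * ?t" by (simp add: M_def algebra_simps)
    finally show ?thesis .
  qed
  moreover have "M \<ge> 0" using K(1) L(1) assms(3) by (simp add: M_def)
  ultimately show ?thesis by blast
qed

section \<open>Perturbing a polynomial whose maximum lies on the axis\<close>

lemma cmod_add_scaled_squared:
  "(cmod (u + of_real \<eta> * v))\<^sup>2 = (cmod u)\<^sup>2 + 2 * \<eta> * Re (u * cnj v) + \<eta>\<^sup>2 * Re (v * cnj v)"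
  unfolding cmod_power2 by (simp add: algebra_simps power2_eq_square)

text \<open>
  The gain \<open>c * (cmod z - Re z)\<close> of the unperturbed polynomial and the change caused by a
  perturbation with real coefficients have the same order, so a small enough factor decides for
  the gain, uniformly up to the axis.
\<close>

lemma small_perturbation_max_on_axis:
  fixes q s :: "complex poly"
  assumes "\<And>i. coeff q i \<in> \<real>" and "\<And>i. coeff s i \<in> \<real>" and "R \<ge> 0" and "c > 0"
    and gain: "\<And>z. z \<in> A \<Longrightarrow>
      (cmod (poly q z))\<^sup>2 \<le> (cmod (poly q (cmod z)))\<^sup>2 - c * (cmod z - Re z)"
    and A: "A \<subseteq> cball 0 R"
  shows "\<exists>\<epsilon>>0. \<forall>\<eta> z. \<bar>\<eta>\<bar> \<le> \<epsilon> \<longrightarrow> z \<in> A \<longrightarrow> Re z \<noteq> cmod z \<longrightarrow>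
    cmod (poly q z + of_real \<eta> * poly s z) < cmod (poly q (cmod z) + of_real \<eta> * poly s (cmod z))"
proof -
  obtain K where K: "K \<ge> 0" "\<And>z. cmod z \<le> R \<Longrightarrow>
    \<bar>Re (poly q z * cnj (poly s z)) - Re (poly q (cmod z) * cnj (poly s (cmod z)))\<bar>
      \<le> K * (cmod z - Re z)"
    using real_poly_product_deviation[OF assms(1,2,3)] by blast
  obtain L where L: "L \<ge> 0" "\<And>z. cmod z \<le> R \<Longrightarrow>
    \<bar>Re (poly s z * cnj (poly s z)) - Re (poly s (cmod z) * cnj (poly s (cmod z)))\<bar>
      \<le> L * (cmod z - Re z)"
    using real_poly_product_deviation[OF assms(2,2,3)] by blast
  \<comment> \<open>The bound \<open>1\<close> gives \<open>\<eta>\<^sup>2 \<le> \<epsilon>\<close>; the other one makes the total change \<open>\<epsilon> (2 K + L)\<close>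
    strictly smaller than the gain \<open>c\<close>.\<close>
  define \<epsilon> where "\<epsilon> = min 1 (c / (2 * K + L + 1))"
  have pos: "\<epsilon> > 0" using K(1) L(1) \<open>c > 0\<close> by (simp add: \<epsilon>_def)
  have "\<epsilon> * (2 * K + L + 1) \<le> c / (2 * K + L + 1) * (2 * K + L + 1)"
    using K(1) L(1) by (intro mult_right_mono) (auto simp: \<epsilon>_def)
  then have "\<epsilon> * (2 * K + L + 1) \<le> c" using K(1) L(1) by simp
  then have small: "\<epsilon> * (2 * K + L) < c" using pos by (simp add: algebra_simps)
  have "cmod (poly q z + of_real \<eta> * poly s z) < cmod (poly q (cmod z) + of_real \<eta> * poly s (cmod z))"
    if \<eta>: "\<bar>\<eta>\<bar> \<le> \<epsilon>" and z: "z \<in> A" "Re z \<noteq> cmod z" for \<eta> z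
  proof -
    let ?r = "complex_of_real (cmod z)" and ?t = "cmod z - Re z"
    let ?X = "Re (poly q z * cnj (poly s z))" and ?X' = "Re (poly q ?r * cnj (poly s ?r))"
    let ?Y = "Re (poly s z * cnj (poly s z))" and ?Y' = "Re (poly s ?r * cnj (poly s ?r))"
    have t: "?t > 0" using z(2) complex_Re_le_cmod[of z] by simp
    have zR: "cmod z \<le> R" using z(1) A by auto
    have "\<bar>2 * \<eta> * (?X - ?X')\<bar> \<le> (2 * \<epsilon>) * (K * ?t)"
      unfolding abs_mult using \<eta> pos K(2)[OF zR] by (intro mult_mono) auto
    moreover have "\<bar>\<eta>\<^sup>2 * (?Y - ?Y')\<bar> \<le> \<epsilon> * (L * ?t)"
    proof -
      have "\<bar>\<eta>\<bar> * \<bar>\<eta>\<bar> \<le> \<epsilon> * 1" using \<eta> pos by (intro mult_mono) (auto simp: \<epsilon>_def)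
      then have "\<eta>\<^sup>2 \<le> \<epsilon>" by (simp add: power2_eq_square)
      then show ?thesis unfolding abs_mult using pos L(2)[OF zR] by (intro mult_mono) auto
    qed
    moreover have "\<epsilon> * (2 * K + L) * ?t < c * ?t" using small t by simp
    ultimately have "2 * \<eta> * (?X - ?X') + \<eta>\<^sup>2 * (?Y - ?Y') < c * ?t"
      by (simp add: algebra_simps)
    then have "(cmod (poly q z + of_real \<eta> * poly s z))\<^sup>2
        < (cmod (poly q ?r + of_real \<eta> * poly s ?r))\<^sup>2"
      using gain[OF z(1)] unfolding cmod_add_scaled_squared by (simp add: algebra_simps)
    then show ?thesis by (rule power_less_imp_less_base) simp
  qed
  then show ?thesis using pos by blast
qed

text \<open>
  The gain required above, from \<open>(cmod (z\<^sup>2 + 1))\<^sup>2 = (r\<^sup>2 + 1)\<^sup>2 - 4 (Im z)\<^sup>2\<close> with \<open>r = cmod z\<close>.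
  In the right half plane \<open>(Im z)\<^sup>2 = (r - Re z) (r + Re z) \<ge> r (r - Re z)\<close>.
\<close>

lemma cmod_dominant_poly_le:
  assumes "0 < \<rho>" and "\<rho> \<le> cmod z" and "Re z \<ge> 0"
  shows "(cmod (z ^ m * (z\<^sup>2 + 1)))\<^sup>2
    \<le> (cmod (of_real (cmod z) ^ m * ((of_real (cmod z))\<^sup>2 + 1)))\<^sup>2
      - 4 * \<rho> * (\<rho> ^ m)\<^sup>2 * (cmod z - Re z)"
proof -
  let ?r = "cmod z" and ?t = "cmod z - Re z"
  have t: "?t \<ge> 0" using complex_Re_le_cmod[of z] by simp
  have "(cmod (z\<^sup>2 + 1))\<^sup>2 = (((Re z)\<^sup>2 + (Im z)\<^sup>2) + 1)\<^sup>2 - 4 * (Im z)\<^sup>2"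
    unfolding cmod_power2 by (simp add: power2_eq_square algebra_simps)
  then have eq: "(cmod (z\<^sup>2 + 1))\<^sup>2 = (?r\<^sup>2 + 1)\<^sup>2 - 4 * (Im z)\<^sup>2"
    by (simp add: cmod_power2)
  have "\<rho> * ?t \<le> (Im z)\<^sup>2"
    unfolding Im_squared_eq using assms t by (subst mult.commute, intro mult_left_mono) auto
  moreover have "(\<rho> ^ m)\<^sup>2 \<le> (?r ^ m)\<^sup>2"
    using assms by (intro power_mono) auto
  ultimately have "(\<rho> ^ m)\<^sup>2 * (\<rho> * ?t) \<le> (?r ^ m)\<^sup>2 * (Im z)\<^sup>2"
    using assms t by (intro mult_mono) auto
  moreover have "cmod (of_real ?r ^ m * ((of_real ?r)\<^sup>2 + 1)) = ?r ^ m * (?r\<^sup>2 + 1)"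
  proof -
    have "of_real ?r ^ m * ((of_real ?r)\<^sup>2 + 1) = complex_of_real (?r ^ m * (?r\<^sup>2 + 1))" by simp
    then show ?thesis by (simp only: norm_of_real) simp
  qed
  moreover have "(cmod (z ^ m * (z\<^sup>2 + 1)))\<^sup>2 = (?r ^ m)\<^sup>2 * (?r\<^sup>2 + 1)\<^sup>2 - 4 * ((?r ^ m)\<^sup>2 * (Im z)\<^sup>2)"
    by (simp add: norm_mult norm_power power_mult_distrib eq right_diff_distrib)
  ultimately show ?thesis
    by (simp add: power_mult_distrib mult.assoc mult.left_commute)
qed

section \<open>The touching factor\<close>

text \<open>
  The factors are squared so that the values on the real axis are nonnegative and touch zero at
  the prescribed points; evenness in \<open>z\<close> makes the perturbation act with opposite relative signs
  on the two half axes, where the odd dominant polynomial changes sign.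
\<close>

definition touching_poly :: "nat \<Rightarrow> (nat \<Rightarrow> real) \<Rightarrow> complex poly" where
  "touching_poly n a = (\<Prod>k = 1..n. [:- (complex_of_real (a k))\<^sup>2, 0, 1:]\<^sup>2)"

lemma poly_touching_poly: "poly (touching_poly n a) z = (\<Prod>k = 1..n. (z\<^sup>2 - (of_real (a k))\<^sup>2)\<^sup>2)"
  by (simp add: touching_poly_def poly_prod poly_power flip: power2_eq_square)

lemma poly_touching_poly_of_real:
  "poly (touching_poly n a) (of_real x) = of_real (\<Prod>k = 1..n. (x\<^sup>2 - (a k)\<^sup>2)\<^sup>2)"
  by (simp add: poly_touching_poly)

lemma degree_touching_poly: "degree (touching_poly n a) = 4 * n"
proof -
  have "degree (touching_poly n a) = (\<Sum>k = 1..n. degree ([:- (complex_of_real (a k))\<^sup>2, 0, 1:]\<^sup>2))"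
    unfolding touching_poly_def by (rule degree_prod_eq_sum_degree) auto
  then show ?thesis by (simp add: degree_power_eq)
qed

lemma coeff_mult_Reals:
  fixes p q :: "complex poly"
  assumes "\<And>i. coeff p i \<in> \<real>" and "\<And>i. coeff q i \<in> \<real>"
  shows "coeff (p * q) i \<in> \<real>"
  unfolding coeff_mult using assms by (intro sum_in_Reals) auto

lemma coeff_touching_poly_Reals: "coeff (touching_poly n a) i \<in> \<real>"
proof -
  have "coeff [:- (complex_of_real c)\<^sup>2, 0, 1:] i \<in> \<real>" for c i
    by (auto simp: coeff_pCons split: nat.split)
  then have factor: "coeff ([:- (complex_of_real c)\<^sup>2, 0, 1:]\<^sup>2) i \<in> \<real>" for c i
    by (subst power2_eq_square) (rule coeff_mult_Reals)
  have "coeff (\<Prod>k\<in>B. [:- (complex_of_real (a k))\<^sup>2, 0, 1:]\<^sup>2) i \<in> \<real>" if "finite B" for B i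
    using that
  proof (induction B arbitrary: i rule: finite_induct)
    case empty
    then show ?case by (simp add: coeff_1)
  next
    case (insert k B)
    show ?case
      unfolding prod.insert[OF insert.hyps]
      by (intro coeff_mult_Reals factor insert.IH)
  qed
  then show ?thesis by (simp add: touching_poly_def)
qed

section \<open>Isolated points of the maximum modulus set\<close>

lemma isolated_point_singleton_component:
  fixes x :: "'a::t1_space"
  assumes "open U" and "S \<inter> U = {x}"
  shows "{x} \<in> components S"
proof -
  let ?C = "connected_component_set S x"
  have x: "x \<in> S" "x \<in> U" using assms(2) by auto
  have xC: "x \<in> ?C" using x(1) by simp
  have "?C \<inter> U = {x}" using assms(2) xC x connected_component_subset[of S x] by auto
  then have "openin (top_of_set ?C) {x}" using assms(1) by (metis openin_open_Int)
  moreover have "closedin (top_of_set ?C) {x}" using xC by (simp add: closed_subset)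
  ultimately have "{x} = ?C"
    using connected_connected_component[of S x] unfolding connected_clopen by blast
  then show ?thesis using x(1) by (metis componentsI)
qed

lemma max_modulus_eqI:
  assumes "w \<in> sphere 0 r" and "\<And>z. z \<in> sphere 0 r \<Longrightarrow> cmod (f z) \<le> cmod (f w)"
  shows "max_modulus r f = cmod (f w)"
  unfolding max_modulus_def using assms by (intro cSup_eq_maximum) auto

theorem theorem1p3:
  fixes n :: nat and a :: "nat \<Rightarrow> real"
  assumes "\<And>k. k \<in> {1..n} \<Longrightarrow> a k > 0"
    and "inj_on a {1..n}"
  shows "\<exists>p :: complex poly. degree p = 4 * n + 1 \<and>
    (\<forall>k\<in>{1..n}. {complex_of_real (a k)} \<in> components (max_modulus_set (poly p)))"
proof (cases "n = 0")
  case True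
  then show ?thesis by (intro exI[of _ "[:0, 1:]"]) simp
next
  case False
  define m where "m = 4 * n - 1"
  have m: "odd m" "m + 2 = 4 * n + 1" using False by (auto simp: m_def)
  define q :: "complex poly" where "q = monom 1 (m + 2) + monom 1 m"
  let ?E = "touching_poly n a"
  have poly_q: "poly q z = z ^ m * (z\<^sup>2 + 1)" for z
    by (simp add: q_def poly_monom power_add algebra_simps power2_eq_square)
  have q_real: "coeff q i \<in> \<real>" for i by (simp add: q_def)
  define \<rho> where "\<rho> = Min (a ` {1..n}) / 2"
  define R where "R = Max (a ` {1..n}) + 1"
  have ne: "finite (a ` {1..n})" "a ` {1..n} \<noteq> {}" using False by auto
  have \<rho>: "\<rho> > 0" using assms(1) Min_in[OF ne] by (auto simp: \<rho>_def)
  have annulus: "\<rho> < a k \<and> a k < R" if "k \<in> {1..n}" for k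
  proof -
    have "a k \<in> a ` {1..n}" using that by blast
    then show ?thesis
      using Min_le[OF ne(1), of "a k"] Max_ge[OF ne(1), of "a k"] assms(1)[OF that]
      unfolding \<rho>_def R_def by linarith
  qed
  have R: "R \<ge> 0" using annulus[of 1] \<rho> False by auto
  define A where "A = {z. \<rho> \<le> cmod z \<and> cmod z \<le> R \<and> Re z \<ge> 0}"
  have "\<exists>\<epsilon>>0. \<forall>\<eta> z. \<bar>\<eta>\<bar> \<le> \<epsilon> \<longrightarrow> z \<in> A \<longrightarrow> Re z \<noteq> cmod z \<longrightarrow>
      cmod (poly q z + of_real \<eta> * poly ?E z) < cmod (poly q (cmod z) + of_real \<eta> * poly ?E (cmod z))"
  proof (rule small_perturbation_max_on_axis)
    show "(cmod (poly q z))\<^sup>2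
        \<le> (cmod (poly q (cmod z)))\<^sup>2 - 4 * \<rho> * (\<rho> ^ m)\<^sup>2 * (cmod z - Re z)" if "z \<in> A" for z
      unfolding poly_q using that \<rho> by (intro cmod_dominant_poly_le) (auto simp: A_def)
  qed (use q_real coeff_touching_poly_Reals R \<rho> in \<open>auto simp: A_def\<close>)
  then obtain \<epsilon> where \<epsilon>: "\<epsilon> > 0" "\<And>\<eta> z. \<lbrakk>\<bar>\<eta>\<bar> \<le> \<epsilon>; z \<in> A; Re z \<noteq> cmod z\<rbrakk> \<Longrightarrow>
      cmod (poly q z + of_real \<eta> * poly ?E z) < cmod (poly q (cmod z) + of_real \<eta> * poly ?E (cmod z))"
    by blast
  define p where "p = q - smult (of_real \<epsilon>) ?E"
  have poly_p: "poly p z = poly q z - of_real \<epsilon> * poly ?E z" for z by (simp add: p_def)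
  have deg: "degree p = 4 * n + 1"
  proof -
    have "degree q = m + 2"
      unfolding q_def by (subst degree_add_eq_left) (auto simp: degree_monom_eq)
    then show ?thesis
      unfolding p_def diff_conv_add_uminus using m(2) \<epsilon>(1)
      by (subst degree_add_eq_left) (auto simp: degree_touching_poly)
  qed
  define Er where "Er x = (\<Prod>k = 1..n. (x\<^sup>2 - (a k)\<^sup>2)\<^sup>2)" for x
  define qr where "qr x = x ^ m * (x\<^sup>2 + 1)" for x :: real
  have Er_nonneg: "Er x \<ge> 0" for x unfolding Er_def by (intro prod_nonneg) auto
  have qr_pos: "qr x > 0" if "x > 0" for x
    using that by (simp add: qr_def add_nonneg_pos)
  have E_even: "poly ?E (- z) = poly ?E z" for z by (simp add: poly_touching_poly)
  have q_odd: "poly q (- z) = - poly q z" for z using m(1) by (simp add: poly_q)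
  have E_r: "poly ?E (of_real x) = of_real (Er x)" for x
    by (simp add: poly_touching_poly_of_real Er_def)
  have q_r: "poly q (of_real x) = of_real (qr x)" for x by (simp add: poly_q qr_def)
  have right: "cmod (poly p x) = \<bar>qr x - \<epsilon> * Er x\<bar>" for x :: real
  proof -
    have "poly p x = of_real (qr x - \<epsilon> * Er x)" by (simp add: poly_p E_r q_r)
    then show ?thesis by (simp only: norm_of_real)
  qed
  have left: "cmod (poly p (- of_real x)) = qr x + \<epsilon> * Er x" if "x > 0" for x :: real
  proof -
    have "poly p (- of_real x) = - of_real (qr x + \<epsilon> * Er x)"
      by (simp add: poly_p E_r q_r E_even q_odd)
    then show ?thesis using qr_pos[OF that] Er_nonneg[of x] \<epsilon>(1)
      by (simp only: norm_minus_cancel norm_of_real) auto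
  qed
  have right_le_left: "cmod (poly p x) \<le> cmod (poly p (- of_real x))" if "x > 0" for x :: real
    using right[of x] left[OF that] qr_pos[OF that] Er_nonneg[of x] \<epsilon>(1)
    by (simp add: abs_le_iff)
  have off_axis: "cmod (poly p z) < cmod (poly p (cmod z))" if "z \<in> A" "Re z \<noteq> cmod z" for z
    using \<epsilon>(2)[of "- \<epsilon>" z] that \<epsilon>(1) by (simp add: poly_p)
  have on_axis: "z = cmod z" if "Re z = cmod z" for z
    using that Im_squared_eq[of z] by (simp add: complex_eq_iff)
  have bound: "cmod (poly p z) \<le> cmod (poly p (- of_real (cmod z)))"
    if z: "\<rho> \<le> cmod z" "cmod z \<le> R" for z
  proof (cases "Re z \<ge> 0")
    case True
    then have "cmod (poly p z) \<le> cmod (poly p (cmod z))"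
      using off_axis[of z] on_axis[of z] z by (cases "Re z = cmod z") (auto simp: A_def)
    also have "\<dots> \<le> cmod (poly p (- of_real (cmod z)))"
      using z(1) \<rho> by (intro right_le_left) linarith
    finally show ?thesis .
  next
    case False
    \<comment> \<open>Up to sign, \<open>z \<mapsto> - z\<close> turns the perturbation \<open>- \<epsilon>\<close> into \<open>\<epsilon>\<close>.\<close>
    have flip: "cmod (poly p (- w)) = cmod (poly q w + of_real \<epsilon> * poly ?E w)" for w
    proof -
      have "poly p (- w) = - (poly q w + of_real \<epsilon> * poly ?E w)"
        by (simp add: poly_p E_even q_odd)
      then show ?thesis by (simp only: norm_minus_cancel)
    qed
    show ?thesis
    proof (cases "Re (- z) = cmod (- z)")
      case True
      then show ?thesis using on_axis[of "- z"] by (metis minus_minus norm_minus_cancel order_refl)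
    next
      case off: False
      have "- z \<in> A" using False z by (auto simp: A_def)
      from \<epsilon>(2)[OF _ this off, of \<epsilon>] show ?thesis
        using \<epsilon>(1) flip[of "- z"] flip[of "of_real (cmod z)"] by simp
    qed
  qed
  have max_p: "max_modulus r (poly p) = cmod (poly p (- of_real r))" if "\<rho> \<le> r" "r \<le> R" for r
    using bound that \<rho> by (intro max_modulus_eqI) auto
  have "{complex_of_real (a k)} \<in> components (max_modulus_set (poly p))" if k: "k \<in> {1..n}" for k
  proof (rule isolated_point_singleton_component)
    \<comment> \<open>The prescribed points other than \<open>a k\<close>, to be cut out of the right half annulus.\<close>
    define F where "F = complex_of_real ` (a ` {1..n} - {a k})"
    define U where "U = {z. \<rho> < cmod z} \<inter> {z. cmod z < R} \<inter> {z. 0 < Re z} \<inter> - F"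
    have "closed F" unfolding F_def by (intro finite_imp_closed) auto
    then show "open U"
      unfolding U_def by (intro open_Int open_Compl open_Collect_less continuous_intros)
    have Er_a: "Er (a k) = 0" using k by (auto simp: Er_def)
    have "complex_of_real (a k) \<in> max_modulus_set (poly p)"
      using max_p[of "a k"] annulus[OF k] assms(1)[OF k] right[of "a k"] left[of "a k"]
        qr_pos[of "a k"] Er_a by (simp add: max_modulus_set_def)
    moreover have "complex_of_real (a k) \<in> U"
      using annulus[OF k] assms(1)[OF k] by (auto simp: U_def F_def)
    moreover have "z = a k" if z: "z \<in> max_modulus_set (poly p)" "z \<in> U" for z
    proof -
      let ?r = "cmod z"
      have zA: "z \<in> A" "\<rho> \<le> ?r" "?r \<le> R" "?r > 0" "z \<notin> F"
        using z(2) \<rho> by (auto simp: U_def A_def)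
      have max: "cmod (poly p z) = cmod (poly p (- of_real ?r))"
        using z(1) max_p[OF zA(2,3)] by (simp add: max_modulus_set_def)
      then have "Re z = ?r" using off_axis[OF zA(1)] right_le_left[OF zA(4)] by force
      then have zr: "z = of_real ?r" by (rule on_axis)
      have "\<bar>qr ?r - \<epsilon> * Er ?r\<bar> = qr ?r + \<epsilon> * Er ?r"
        using max right[of ?r] left[OF zA(4)] zr by simp
      then have "\<epsilon> * Er ?r = 0" using qr_pos[OF zA(4)] by (auto simp: abs_if split: if_splits)
      then obtain j where j: "j \<in> {1..n}" "?r\<^sup>2 = (a j)\<^sup>2" using \<epsilon>(1) by (auto simp: Er_def)
      then have "?r = a j" using assms(1)[OF j(1)] zA(4) by (simp add: power2_eq_iff_nonneg)
      then have "?r = a k" using zA(5) zr j(1) by (auto simp: F_def)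
      then show ?thesis using zr by simp
    qed
    ultimately show "max_modulus_set (poly p) \<inter> U = {complex_of_real (a k)}" by blast
  qed
  then show ?thesis using deg by blast
qed

end
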